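(* Let $\{x_k\}$ be generated by the simplified stochastic SQP algorithm described in the context for the problem $\min_{x\in C} r(x)=\mathbb{E}[R(x,\xi)]$, with variance bounds $M_k$. If $\sum_{k=0}^{\infty}M_k<\infty$, then, with probability 1, any accumulation point $\bar x$ of $\{x_k\}$ is a KKT point of the problem, i.e. $\bar x\in C$ and $0\in\bar\partial r(\bar x)+\bar\partial i_C(\bar x)$.
   Context: $\|\cdot\|$ is the Euclidean norm, $\bar\partial$ the Clarke subdifferential, $i_C$ the indicator function of $C$ ($0$ on $C$, $+\infty$ outside). Standing assumptions: (i) $r:\mathbb{R}^n\to\mathbb{R}$, $r(x)=\mathbb{E}[R(x,\xi)]$ with $\xi$ a random vector, is Lipschitz continuous and upper-$\mathcal{C}^2$ (i.e. locally $r(x)=\min_{t\in T}p(t,x)$ with $T$ compact and $p$ and its first and second partial derivatives in $x$ continuous in $(t,x)$); $\rho>0$ is a constant such that $r(x)-r(\bar x)-\langle g,x-\bar x\rangle\le\frac{\rho}{2}\|x-\bar x\|^2$ for all $x,\bar x\in C$ and $g\in\bar\partial r(\bar x)$. (ii) $C\subset\mathbb{R}^n$ is (nonempty) convex and compact. Algorithm: fix $\eta_\alpha>1$, $x_0\in C$, $\alpha_0\in[\rho,\eta_\alpha\rho]$. For $k=0,1,2,\dots$: draw a set $S_k$ of i.i.d. samples of $\xi$, compute a stochastic estimate $\bar g_k$ of a subgradient $g_k\in\bar\partial r(x_k)$; let $\bar d_k$ be the solution of $\min_{d:\,x_k+d\in C}\ \bar g_k^Td+\frac12\alpha_k\|d\|^2$;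 set $x_{k+1}=x_k+\bar d_k$; choose $\alpha_{k+1}\in[\alpha_k,\eta_\alpha\rho]$, the choice of $\alpha_k$ being independent of the stochastic estimates. Noise assumption: for all $k$, $\mathbb{E}_k[\bar g_k]=g_k$ and $\mathbb{E}_k[\|\bar g_k-g_k\|^2]\le M_k$, where $M_k>0$ is a sequence independent of the stochastic solutions (deterministic), and $\mathbb{E}_k$ is the expectation conditioned on the iterate $x_k$ (i.e. on the samples that generated $x_k$). *)

theory Defs
  imports "HOL-Probability.Probability" "HOL-Library.Set_Algebras"
begin

subsection \<open>Clarke subdifferentials\<close>

text \<open>For a (locally) Lipschitz real-valued function the Clarke subdifferential is defined through
  the generalized directional derivative
  \<open>f\<degree>(x; v) = limsup (f (y + t v) - f y) / t\<close> as \<open>y \<rightarrow> x\<close> and \<open>t \<down> 0\<close>.\<close>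

definition clarke_dd :: "('a::euclidean_space \<Rightarrow> real) \<Rightarrow> 'a \<Rightarrow> 'a \<Rightarrow> ereal" where
  "clarke_dd f x v =
     Limsup (nhds x \<times>\<^sub>F at_right 0) (\<lambda>(y, t). ereal ((f (y + t *\<^sub>R v) - f y) / t))"

definition clarke_subdiff :: "('a::euclidean_space \<Rightarrow> real) \<Rightarrow> 'a \<Rightarrow> 'a set" where
  "clarke_subdiff f x = {g. \<forall>v. ereal (g \<bullet> v) \<le> clarke_dd f x v}"

text \<open>For an extended-real-valued function, such as the indicator function of a set, the Clarke
  subdifferential is defined, following Clarke and Rockafellar, through the Clarke normal cone of
  the epigraph; on locally Lipschitz functions the two definitions agree.\<close>

definition clarke_tangent_cone :: "'a::euclidean_space set \<Rightarrow> 'a \<Rightarrow> 'a set" where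
  "clarke_tangent_cone S x =
     {v. \<forall>y t. (\<forall>n::nat. y n \<in> S) \<longrightarrow> y \<longlonglongrightarrow> x \<longrightarrow> (\<forall>n. (t n :: real) > 0) \<longrightarrow> t \<longlonglongrightarrow> 0 \<longrightarrow>
           (\<exists>w. w \<longlonglongrightarrow> v \<and> (\<forall>n. y n + t n *\<^sub>R w n \<in> S))}"

definition clarke_normal_cone :: "'a::euclidean_space set \<Rightarrow> 'a \<Rightarrow> 'a set" where
  "clarke_normal_cone S x = {z. \<forall>v\<in>clarke_tangent_cone S x. z \<bullet> v \<le> 0}"

definition epigraph_ereal :: "('a \<Rightarrow> ereal) \<Rightarrow> ('a \<times> real) set" where
  "epigraph_ereal f = {(x, s). f x \<le> ereal s}"

definition clarke_subdiff_ereal :: "('a::euclidean_space \<Rightarrow> ereal) \<Rightarrow> 'a \<Rightarrow> 'a set" where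
  "clarke_subdiff_ereal f x =
     (if \<bar>f x\<bar> = \<infinity> then {}
      else {g. (g, -1) \<in> clarke_normal_cone (epigraph_ereal f) (x, real_of_ereal (f x))})"

definition indicator_ereal :: "'a set \<Rightarrow> 'a \<Rightarrow> ereal" where
  "indicator_ereal C x = (if x \<in> C then 0 else \<infinity>)"

text \<open>The sum of the two subdifferentials is the Minkowski sum.\<close>

definition kkt_point :: "('a::euclidean_space \<Rightarrow> real) \<Rightarrow> 'a set \<Rightarrow> 'a \<Rightarrow> bool" where
  "kkt_point f C x \<longleftrightarrow>
     x \<in> C \<and> 0 \<in> clarke_subdiff f x + clarke_subdiff_ereal (indicator_ereal C) x"


subsection \<open>Upper-C2 functions\<close>

text \<open>The compact index space \<open>T\<close> and the representing family \<open>p\<close> may depend on the base point.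
  HOL cannot quantify existentially over the type carrying \<open>T\<close>, hence the type argument; \<open>p1\<close> and
  \<open>p2\<close> are the first and second partial derivatives of \<open>p\<close> in \<open>x\<close>.\<close>

definition upper_C2 :: "'t itself \<Rightarrow> ('a::euclidean_space \<Rightarrow> real) \<Rightarrow> bool" where
  "upper_C2 _ f \<longleftrightarrow>
     (\<forall>x0. \<exists>V (T :: 't topology) (p :: 't \<Rightarrow> 'a \<Rightarrow> real)
            (p1 :: 'a \<Rightarrow> 't \<Rightarrow> 'a \<Rightarrow> real) (p2 :: 'a \<Rightarrow> 'a \<Rightarrow> 't \<Rightarrow> 'a \<Rightarrow> real).
        open V \<and> x0 \<in> V \<and> compact_space T \<and>
        (\<forall>x\<in>V. (\<forall>t\<in>topspace T. f x \<le> p t x) \<and> (\<exists>t\<in>topspace T. f x = p t x)) \<and>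
        (\<forall>t\<in>topspace T. \<forall>x\<in>V. \<forall>i\<in>Basis.
           ((\<lambda>s. p t (x + s *\<^sub>R i)) has_real_derivative p1 i t x) (at 0)) \<and>
        (\<forall>t\<in>topspace T. \<forall>x\<in>V. \<forall>i\<in>Basis. \<forall>j\<in>Basis.
           ((\<lambda>s. p1 i t (x + s *\<^sub>R j)) has_real_derivative p2 i j t x) (at 0)) \<and>
        continuous_map (prod_topology T (top_of_set V)) euclideanreal (\<lambda>(t, x). p t x) \<and>
        (\<forall>i\<in>Basis.
           continuous_map (prod_topology T (top_of_set V)) euclideanreal (\<lambda>(t, x). p1 i t x)) \<and>
        (\<forall>i\<in>Basis. \<forall>j\<in>Basis.
           continuous_map (prod_topology T (top_of_set V)) euclideanreal (\<lambda>(t, x). p2 i j t x)))"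


subsection \<open>Information generated by the samples\<close>

text \<open>At iteration \<open>j\<close> the samples \<open>S j 0, \<dots>, S j (N j - 1)\<close> are drawn. The iterate with index \<open>k\<close> is
  generated by the samples of the iterations \<open>j < k\<close>; conditioning on it means conditioning on
  the sigma-algebra below. For \<open>k = 0\<close> this is the trivial sigma-algebra.\<close>

definition past_samples ::
    "'w measure \<Rightarrow> (nat \<Rightarrow> nat) \<Rightarrow> (nat \<Rightarrow> nat \<Rightarrow> 'w \<Rightarrow> 'z::euclidean_space) \<Rightarrow> nat \<Rightarrow> 'w measure" where
  "past_samples P N S k =
     sigma (space P) {S j i -` A \<inter> space P | j i A. j < k \<and> i < N j \<and> A \<in> sets borel}"


subsection \<open>Accumulation points of sequences\<close>

definition accumulation_point :: "(nat \<Rightarrow> 'a::topological_space) \<Rightarrow> 'a \<Rightarrow> bool" where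
  "accumulation_point u l \<longleftrightarrow> (\<exists>s. strict_mono s \<and> (u \<circ> s) \<longlonglongrightarrow> l)"

end

theory Submission
  imports Defs
begin

text \<open>The step is a projection: \<open>x\<^sub>k\<^sub>+\<^sub>1\<close> is the point of \<open>C\<close> closest to
  \<open>x\<^sub>k - gbar\<^sub>k / \<alpha>\<^sub>k\<close>. Replacing \<open>gbar\<^sub>k\<close> by \<open>g\<^sub>k\<close> gives a
  step \<open>d\<^sub>k\<close> that is determined by the past, hence uncorrelated with the noise
  \<open>e\<^sub>k = gbar\<^sub>k - g\<^sub>k\<close>, and that differs from the actual step by at most
  \<open>norm e\<^sub>k / \<alpha>\<^sub>k\<close>. The descent inequality therefore loses only a multiple of \<open>M\<^sub>k\<close> in
  expectation, so that both the squared steps and the squared noise are summable in expectation and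
  tend to zero almost surely. On that event the variational inequality for the projection
  passes to the limit along a subsequence, because the Clarke subdifferential has closed graph.\<close>

section \<open>Clarke subdifferentials: bound, closed graph, indicator function\<close>

lemma clarke_subdiff_norm_le:
  assumes "L-lipschitz_on UNIV f" "v \<in> clarke_subdiff f x"
  shows "norm v \<le> L"
proof -
  have L: "0 \<le> L" using assms(1) by (rule lipschitz_on_nonneg)
  have q: "(f (y + t *\<^sub>R v) - f y) / t \<le> L * norm v" if "t > 0" for y t
  proof -
    have "\<bar>f (y + t *\<^sub>R v) - f y\<bar> \<le> L * (t * norm v)"
      using lipschitz_onD[OF assms(1), of "y + t *\<^sub>R v" y] that by (simp add: dist_norm)
    then show ?thesis using that by (simp add: field_simps abs_le_iff)
  qed
  have "clarke_dd f x v \<le> ereal (L * norm v)"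
    unfolding clarke_dd_def
  proof (rule Limsup_bounded)
    have "\<forall>\<^sub>F t in at_right (0::real). t > 0" by (rule eventually_at_right_less)
    then have "\<forall>\<^sub>F z in nhds x \<times>\<^sub>F at_right (0::real). snd z > 0"
      unfolding eventually_prod_filter by (intro exI[of _ "\<lambda>_. True"] exI conjI) auto
    then show "\<forall>\<^sub>F z in nhds x \<times>\<^sub>F at_right 0.
        (case z of (y, t) \<Rightarrow> ereal ((f (y + t *\<^sub>R v) - f y) / t)) \<le> ereal (L * norm v)"
      by (rule eventually_mono) (auto simp: q)
  qed
  \<comment> \<open>The direction tested is the subgradient itself, so that
    \<open>(norm v)\<^sup>2\<close> is compared with \<open>L * norm v\<close>.\<close>
  moreover have "ereal (v \<bullet> v) \<le> clarke_dd f x v"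
    using assms(2) by (auto simp: clarke_subdiff_def)
  ultimately have "v \<bullet> v \<le> L * norm v"
    by (metis ereal_less_eq(3) order_trans)
  then have "norm v * norm v \<le> L * norm v"
    by (simp add: dot_square_norm power2_eq_square)
  then show ?thesis using L by (cases "v = 0") auto
qed

text \<open>The generalized directional derivative is upper semicontinuous in the base point: a
  strict bound on it at \<open>x\<close> bounds the difference quotients at all points near
  \<open>x\<close>, and hence also the derivative at each nearby base point.\<close>

lemma clarke_subdiff_closed_graph:
  assumes "u \<longlonglongrightarrow> x" "v \<longlonglongrightarrow> w" "\<And>n. v n \<in> clarke_subdiff f (u n)"
  shows "w \<in> clarke_subdiff f x"
  unfolding clarke_subdiff_def
proof (intro CollectI allI, rule ccontr)
  fix z assume "\<not> ereal (w \<bullet> z) \<le> clarke_dd f x z"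
  then obtain c where c: "clarke_dd f x z < ereal c" "ereal c < ereal (w \<bullet> z)"
    using ereal_dense2[of "clarke_dd f x z" "ereal (w \<bullet> z)"] by (metis not_le)
  let ?q = "\<lambda>(y, t). ereal ((f (y + t *\<^sub>R z) - f y) / t)"
  have "\<forall>\<^sub>F a in nhds x \<times>\<^sub>F at_right 0. ?q a < ereal c"
    using c(1) unfolding clarke_dd_def by (rule Limsup_lessD)
  then obtain A B where AB: "eventually A (nhds x)" "eventually B (at_right 0)"
      "\<And>y t. A y \<Longrightarrow> B t \<Longrightarrow> ?q (y, t) < ereal c"
    unfolding eventually_prod_filter by blast
  obtain U where U: "open U" "x \<in> U" "\<And>y. y \<in> U \<Longrightarrow> A y"
    using AB(1) unfolding eventually_nhds by auto
  have "\<forall>\<^sub>F n in sequentially. u n \<in> U"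
    using assms(1) U by (auto dest: topological_tendstoD)
  then have "\<forall>\<^sub>F n in sequentially. v n \<bullet> z \<le> c"
  proof eventually_elim
    case (elim n)
    \<comment> \<open>\<open>U\<close> is open, so it is a neighbourhood of \<open>u n\<close> as
      well; the bound \<open>B\<close> on the step length is the same for every
      \<open>n\<close>.\<close>
    have "eventually A (nhds (u n))"
      using U elim by (auto simp: eventually_nhds)
    then have "\<forall>\<^sub>F a in nhds (u n) \<times>\<^sub>F at_right 0. ?q a \<le> ereal c"
      unfolding eventually_prod_filter using AB(2,3) by (meson less_imp_le)
    then have "clarke_dd f (u n) z \<le> ereal c"
      unfolding clarke_dd_def by (rule Limsup_bounded)
    moreover have "ereal (v n \<bullet> z) \<le> clarke_dd f (u n) z"
      using assms(3)[of n] by (simp add: clarke_subdiff_def)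
    ultimately show ?case by (metis ereal_less_eq(3) order_trans)
  qed
  moreover have "(\<lambda>n. v n \<bullet> z) \<longlonglongrightarrow> w \<bullet> z" by (intro tendsto_intros assms)
  ultimately have "w \<bullet> z \<le> c"
    by (intro tendsto_upperbound) auto
  then show False using c(2) by simp
qed

text \<open>Supplies the indicator part of the KKT inclusion. The epigraph is \<open>C\<close> times
  the nonnegative half-line, and each tangent direction at \<open>(x, 0)\<close> is a limit of
  directions that lead from \<open>(x, 0)\<close> into it; on those, \<open>(v, -1)\<close> is
  nonpositive.\<close>

lemma clarke_subdiff_indicator_memI:
  fixes x :: "'a::euclidean_space"
  assumes "x \<in> C" "\<And>c. c \<in> C \<Longrightarrow> v \<bullet> (c - x) \<le> 0"
  shows "v \<in> clarke_subdiff_ereal (indicator_ereal C) x"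
proof -
  have epi: "(c, s) \<in> epigraph_ereal (indicator_ereal C) \<longleftrightarrow> c \<in> C \<and> 0 \<le> s" for c s
    by (auto simp: epigraph_ereal_def indicator_ereal_def)
  have "(v, -1) \<bullet> a \<le> 0"
    if a: "a \<in> clarke_tangent_cone (epigraph_ereal (indicator_ereal C)) (x, 0)" for a
  proof -
    \<comment> \<open>Of all the sequences that the tangent cone ranges over, the constant base
      point with steps \<open>1 / (n + 1)\<close> is enough.\<close>
    let ?t = "\<lambda>n. inverse (real (Suc n))"
    have "?t \<longlonglongrightarrow> 0" by (rule LIMSEQ_inverse_real_of_nat)
    then obtain w where w: "w \<longlonglongrightarrow> a"
      "\<And>n. (x, 0) + ?t n *\<^sub>R w n \<in> epigraph_ereal (indicator_ereal C)"
      using a[unfolded clarke_tangent_cone_def, THEN CollectD, rule_format,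
          of "\<lambda>_. (x, 0)" ?t] assms(1)
      by (auto simp: epi)
    have "(v, -1) \<bullet> w n \<le> 0" for n
    proof -
      have *: "x + ?t n *\<^sub>R fst (w n) \<in> C" "0 \<le> ?t n * snd (w n)"
        using w(2)[of n] by (cases "w n"; simp add: epi)+
      have "?t n * (v \<bullet> fst (w n)) \<le> 0"
        using assms(2)[OF *(1)] by (simp only: add_diff_cancel_left' inner_scaleR_right)
      then have "v \<bullet> fst (w n) \<le> 0"
        by (simp add: mult_le_0_iff)
      moreover have "0 \<le> snd (w n)"
        using *(2) by (simp add: zero_le_mult_iff)
      ultimately show ?thesis by (cases "w n") simp
    qed
    moreover have "(\<lambda>n. (v, -1) \<bullet> w n) \<longlonglongrightarrow> (v, -1) \<bullet> a" by (intro tendsto_intros w)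
    ultimately show ?thesis by (intro tendsto_upperbound) auto
  qed
  then show ?thesis
    using assms(1)
    by (simp add: clarke_subdiff_ereal_def indicator_ereal_def clarke_normal_cone_def)
qed

section \<open>The quadratic subproblem as a projection\<close>

lemma is_arg_min_prox_step:
  fixes g d x :: "'a::euclidean_space"
  assumes C: "convex C" "closed C" and a: "a > 0"
    and d: "is_arg_min (\<lambda>d. g \<bullet> d + 1 / 2 * a * (norm d)\<^sup>2) (\<lambda>d. x + d \<in> C) d"
  shows "x + d = closest_point C (x - g /\<^sub>R a)"
proof (rule closest_point_unique[OF C])
  show "x + d \<in> C" using d by (simp add: is_arg_min_def)
  \<comment> \<open>Completing the square: up to a constant and the factor \<open>2 / a\<close>, the
    objective at \<open>e\<close> is the squared distance from \<open>x + e\<close> to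
    \<open>x - g /\<^sub>R a\<close>.\<close>
  have sq: "(norm (g /\<^sub>R a + e))\<^sup>2 = (norm g / a)\<^sup>2 + 2 / a * (g \<bullet> e + 1 / 2 * a * (norm e)\<^sup>2)" for e
  proof -
    have "(norm (g /\<^sub>R a + e))\<^sup>2 = (norm (g /\<^sub>R a))\<^sup>2 + 2 * ((g /\<^sub>R a) \<bullet> e) + (norm e)\<^sup>2"
      by (simp only: power2_norm_eq_inner inner_add_left inner_add_right
          inner_commute[of e "g /\<^sub>R a"])
    then show ?thesis using a by (simp add: power_divide field_simps)
  qed
  show "\<forall>z\<in>C. dist (x - g /\<^sub>R a) (x + d) \<le> dist (x - g /\<^sub>R a) z"
  proof
    fix z assume "z \<in> C"
    then have "g \<bullet> d + 1 / 2 * a * (norm d)\<^sup>2 \<le> g \<bullet> (z - x) + 1 / 2 * a * (norm (z - x))\<^sup>2"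
      using d unfolding is_arg_min_def by (metis add.commute diff_add_cancel not_le)
    then have "(norm (g /\<^sub>R a + d))\<^sup>2 \<le> (norm (g /\<^sub>R a + (z - x)))\<^sup>2"
      unfolding sq using a by (intro add_left_mono mult_left_mono) auto
    then have "norm (g /\<^sub>R a + d) \<le> norm (g /\<^sub>R a + (z - x))" by (simp add: power2_le_iff_abs_le)
    then have "dist (x + d) (x - g /\<^sub>R a) \<le> dist z (x - g /\<^sub>R a)"
      by (simp add: dist_norm algebra_simps)
    then show "dist (x - g /\<^sub>R a) (x + d) \<le> dist (x - g /\<^sub>R a) z"
      by (simp only: dist_commute)
  qed
qed

text \<open>The obtuse-angle property of the projection, multiplied by \<open>a\<close>; it is the
  first-order optimality condition of the subproblem.\<close>

lemma prox_step_variational: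
  fixes g d x :: "'a::euclidean_space"
  assumes "convex C" "closed C" "a > 0" "x + d = closest_point C (x - g /\<^sub>R a)" "c \<in> C"
  shows "0 \<le> (g + a *\<^sub>R d) \<bullet> (c - (x + d))"
proof -
  have "((x - g /\<^sub>R a) - (x + d)) \<bullet> (c - (x + d)) \<le> 0"
    unfolding assms(4) by (rule closest_point_dot[OF assms(1,2,5)])
  moreover have "(x - g /\<^sub>R a) - (x + d) = (- inverse a) *\<^sub>R (g + a *\<^sub>R d)"
    using assms(3) by (simp add: algebra_simps)
  ultimately have "- inverse a * ((g + a *\<^sub>R d) \<bullet> (c - (x + d))) \<le> 0"
    by (simp only: inner_scaleR_left)
  then show ?thesis using assms(3) by (simp add: zero_le_mult_iff)
qed

text \<open>The noise is paired with the step from the exact subgradient, a pairing that can average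
  to zero. The remaining pairing, with the difference of the two steps, is of second order in the
  noise because projections are nonexpansive.\<close>

lemma prox_step_descent:
  fixes g g' d x :: "'a::euclidean_space"
  assumes C: "convex C" "closed C" and x: "x \<in> C" and \<rho>: "0 < \<rho>" "\<rho> \<le> a"
    and d: "x + d = closest_point C (x - g' /\<^sub>R a)"
    and r: "r (x + d) - r x - g \<bullet> d \<le> \<rho> / 2 * (norm d)\<^sup>2"
  shows "r (x + d) + \<rho> / 2 * (norm d)\<^sup>2
    \<le> r x - (g' - g) \<bullet> (closest_point C (x - g /\<^sub>R a) - x) + (norm (g' - g))\<^sup>2 / \<rho>"
proof -
  let ?p = "closest_point C (x - g /\<^sub>R a)"
  have "norm (x + d - ?p) \<le> norm ((x - g' /\<^sub>R a) - (x - g /\<^sub>R a))"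
    unfolding d dist_norm[symmetric] using x by (intro closest_point_lipschitz[OF C]) auto
  also have "(x - g' /\<^sub>R a) - (x - g /\<^sub>R a) = (g - g') /\<^sub>R a" by (simp add: algebra_simps)
  also have "norm \<dots> \<le> norm (g' - g) / \<rho>"
    using \<rho> by (simp add: norm_minus_commute divide_simps mult_left_mono)
  finally have n: "norm (x + d - ?p) \<le> norm (g' - g) / \<rho>" .
  have "- ((g' - g) \<bullet> (x + d - ?p)) \<le> norm (g' - g) * norm (x + d - ?p)"
    using Cauchy_Schwarz_ineq2[of "g' - g" "x + d - ?p"] by linarith
  also have "\<dots> \<le> norm (g' - g) * (norm (g' - g) / \<rho>)"
    using n by (intro mult_left_mono) auto
  finally have e: "- ((g' - g) \<bullet> (x + d - ?p)) \<le> (norm (g' - g))\<^sup>2 / \<rho>"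
    by (simp add: power2_eq_square)
  \<comment> \<open>Staying at \<open>x\<close> is feasible, so \<open>x\<close> may be the
    comparison point. The resulting \<open>- \<rho>\<close> outweighs the curvature
    \<open>\<rho> / 2\<close> and leaves \<open>- \<rho> / 2\<close>.\<close>
  have "0 \<le> (g' + a *\<^sub>R d) \<bullet> (x - (x + d))"
    using \<rho> by (intro prox_step_variational[OF C _ d x]) auto
  then have "g' \<bullet> d \<le> - a * (norm d)\<^sup>2"
    by (simp add: inner_add_left power2_norm_eq_inner)
  also have "\<dots> \<le> - \<rho> * (norm d)\<^sup>2" using \<rho> by (intro mult_right_mono) auto
  finally show ?thesis using r e by (simp add: inner_diff_left inner_diff_right inner_add_right)
qed

section \<open>Passage to the limit along a single trajectory\<close>

lemma kkt_point_accumulation: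
  fixes x g g' :: "nat \<Rightarrow> 'a::euclidean_space"
  assumes C: "convex C" "closed C" and r: "L-lipschitz_on UNIV r"
    and x: "\<And>k. x k \<in> C" and g: "\<And>k. g k \<in> clarke_subdiff r (x k)"
    and \<alpha>: "\<And>k. 0 < \<alpha> k" "\<And>k. \<alpha> k \<le> b"
    and step: "\<And>k. x (Suc k) = closest_point C (x k - g' k /\<^sub>R \<alpha> k)"
    and noise: "(\<lambda>k. g' k - g k) \<longlonglongrightarrow> 0" and d: "(\<lambda>k. x (Suc k) - x k) \<longlonglongrightarrow> 0"
    and acc: "accumulation_point x xbar"
  shows "kkt_point r C xbar"
proof -
  obtain s where s: "strict_mono s" "(x \<circ> s) \<longlonglongrightarrow> xbar"
    using acc unfolding accumulation_point_def by blast
  \<comment> \<open>The Lipschitz constant bounds all subgradients, so a second extraction makes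
    them converge along with the iterates.\<close>
  have "bounded (range (g \<circ> s))"
    using clarke_subdiff_norm_le[OF r g] by (auto simp: bounded_iff)
  then obtain w q where q: "strict_mono q" "((g \<circ> s) \<circ> q) \<longlonglongrightarrow> w"
    using bounded_imp_convergent_subsequence[of "g \<circ> s"] by (auto simp: o_assoc)
  define m where "m = s \<circ> q"
  have m: "strict_mono m" using s(1) q(1) by (simp add: m_def strict_mono_o)
  have xm: "(\<lambda>k. x (m k)) \<longlonglongrightarrow> xbar"
    using LIMSEQ_subseq_LIMSEQ[OF s(2) q(1)] by (simp add: m_def o_def)
  have gm: "(\<lambda>k. g (m k)) \<longlonglongrightarrow> w" using q(2) by (simp add: m_def o_def)
  have dm: "(\<lambda>k. x (Suc (m k)) - x (m k)) \<longlonglongrightarrow> 0"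
    using LIMSEQ_subseq_LIMSEQ[OF d m] by (simp add: o_def)
  have nm: "(\<lambda>k. g' (m k) - g (m k)) \<longlonglongrightarrow> 0"
    using LIMSEQ_subseq_LIMSEQ[OF noise m] by (simp add: o_def)
  \<comment> \<open>The variational inequality is based at the new iterate, which therefore needs
    the same limit as the old one.\<close>
  have xS: "(\<lambda>k. x (Suc (m k))) \<longlonglongrightarrow> xbar" using tendsto_add[OF dm xm] by simp
  have g'm: "(\<lambda>k. g' (m k)) \<longlonglongrightarrow> w" using tendsto_add[OF nm gm] by simp
  \<comment> \<open>The upper bound \<open>b\<close> on the weights keeps the scaled steps
    vanishing.\<close>
  have ad: "(\<lambda>k. \<alpha> (m k) *\<^sub>R (x (Suc (m k)) - x (m k))) \<longlonglongrightarrow> 0"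
  proof (rule Lim_null_comparison)
    show "\<forall>\<^sub>F k in sequentially. norm (\<alpha> (m k) *\<^sub>R (x (Suc (m k)) - x (m k)))
        \<le> b * norm (x (Suc (m k)) - x (m k))"
      using \<alpha> by (intro always_eventually allI) (simp add: mult_right_mono less_imp_le)
    show "(\<lambda>k. b * norm (x (Suc (m k)) - x (m k))) \<longlonglongrightarrow> 0"
      using tendsto_mult_left[OF tendsto_norm[OF dm], of b] by simp
  qed
  have xbar: "xbar \<in> C"
    using closed_sequentially[OF C(2) _ xm] x by auto
  have "(- w) \<bullet> (c - xbar) \<le> 0" if "c \<in> C" for c
  proof -
    have "0 \<le> (g' (m k) + \<alpha> (m k) *\<^sub>R (x (Suc (m k)) - x (m k))) \<bullet> (c - x (Suc (m k)))" for k
      using prox_step_variational[OF C \<alpha>(1)[of "m k"] _ that, of "x (m k)"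
          "x (Suc (m k)) - x (m k)" "g' (m k)"] step[of "m k"] by simp
    moreover have "(\<lambda>k. (g' (m k) + \<alpha> (m k) *\<^sub>R (x (Suc (m k)) - x (m k))) \<bullet> (c - x (Suc (m k))))
        \<longlonglongrightarrow> (w + 0) \<bullet> (c - xbar)"
      by (intro tendsto_intros g'm ad xS)
    ultimately have "0 \<le> w \<bullet> (c - xbar)"
      using tendsto_lowerbound by (metis (no_types, lifting) add.right_neutral always_eventually
          trivial_limit_sequentially)
    then show ?thesis by simp
  qed
  then have "- w \<in> clarke_subdiff_ereal (indicator_ereal C) xbar"
    by (rule clarke_subdiff_indicator_memI[OF xbar])
  moreover have "w \<in> clarke_subdiff r xbar"
    using xm gm g by (rule clarke_subdiff_closed_graph)
  ultimately show ?thesis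
    using xbar set_plus_intro[of w "clarke_subdiff r xbar" "- w"] by (simp add: kkt_point_def)
qed

section \<open>Almost sure convergence and the filtration of the samples\<close>

lemma AE_tendsto_zero_of_summable_nn_integral:
  fixes f :: "nat \<Rightarrow> 'w \<Rightarrow> real"
  assumes [measurable]: "\<And>k. f k \<in> borel_measurable M" and f0: "\<And>k w. 0 \<le> f k w"
    and m: "\<And>k. (\<integral>\<^sup>+ w. ennreal (f k w) \<partial>M) \<le> ennreal (m k)" "\<And>k. 0 \<le> m k" "summable m"
  shows "AE w in M. (\<lambda>k. f k w) \<longlonglongrightarrow> 0"
proof -
  \<comment> \<open>Sum and integral are exchanged: the random series has finite expectation, hence
    is finite almost everywhere, and its terms vanish there.\<close>
  have "(\<integral>\<^sup>+ w. (\<Sum>k. ennreal (f k w)) \<partial>M) = (\<Sum>k. \<integral>\<^sup>+ w. ennreal (f k w) \<partial>M)"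
    by (rule nn_integral_suminf) auto
  also have "\<dots> \<le> (\<Sum>k. ennreal (m k))" by (intro suminf_le m) auto
  also have "\<dots> = ennreal (suminf m)" by (intro suminf_ennreal2 m)
  finally have "(\<integral>\<^sup>+ w. (\<Sum>k. ennreal (f k w)) \<partial>M) \<noteq> \<infinity>" by (auto simp: top_unique)
  then have "AE w in M. (\<Sum>k. ennreal (f k w)) \<noteq> \<infinity>"
    by (intro nn_integral_noteq_infinite) auto
  then show ?thesis
  proof eventually_elim
    case (elim w)
    then have "summable (\<lambda>k. f k w)" by (intro summable_suminf_not_top f0) auto
    then show ?case by (rule summable_LIMSEQ_zero)
  qed
qed

lemma subalgebra_past_samples:
  assumes "\<And>j i. i < N j \<Longrightarrow> S j i \<in> borel_measurable P"
  shows "subalgebra P (past_samples P N S k)"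
proof -
  have "sigma_sets (space P) {S j i -` A \<inter> space P | j i A. j < k \<and> i < N j \<and> A \<in> sets borel}
      \<subseteq> sets P"
    using assms by (intro sets.sigma_sets_subset) (auto intro: measurable_sets)
  moreover have "{S j i -` A \<inter> space P | j i A. j < k \<and> i < N j \<and> A \<in> sets borel} \<subseteq> Pow (space P)"
    by auto
  ultimately show ?thesis by (simp add: subalgebra_def past_samples_def space_measure_of_conv)
qed

lemma subalgebra_past_samples_Suc:
  "subalgebra (past_samples P N S (Suc k)) (past_samples P N S k)"
proof -
  let ?G = "\<lambda>k. {S j i -` A \<inter> space P | j i A. j < k \<and> i < N j \<and> A \<in> sets borel}"
  have "sigma_sets (space P) (?G k) \<subseteq> sigma_sets (space P) (?G (Suc k))"
    by (intro sigma_sets_mono') (auto intro: less_SucI)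
  moreover have "?G k \<subseteq> Pow (space P)" for k by auto
  ultimately show ?thesis
    by (simp add: subalgebra_def past_samples_def space_measure_of_conv)
qed

theorem theorem3p10:
  fixes P :: "'w measure"
    and \<xi> :: "'w \<Rightarrow> 'z::euclidean_space"
    and R :: "'a::euclidean_space \<Rightarrow> 'z \<Rightarrow> real"
    and r :: "'a \<Rightarrow> real"
    and C :: "'a set"
    and \<rho> \<eta> :: real
    and N :: "nat \<Rightarrow> nat"
    and S :: "nat \<Rightarrow> nat \<Rightarrow> 'w \<Rightarrow> 'z"
    and \<alpha> M :: "nat \<Rightarrow> real"
    and x0 :: 'a
    and x g gbar dbar :: "nat \<Rightarrow> 'w \<Rightarrow> 'a"
  assumes P: "prob_space P"
    \<comment> \<open>objective\<close>
    and xi: "\<xi> \<in> borel_measurable P"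
    and R_int: "\<And>y. integrable P (\<lambda>\<omega>. R y (\<xi> \<omega>))"
    and r_def: "\<And>y. r y = prob_space.expectation P (\<lambda>\<omega>. R y (\<xi> \<omega>))"
    and r_lipschitz: "\<exists>L. L-lipschitz_on UNIV r"
    and r_upper_C2: "upper_C2 TYPE('t) r"
    and rho_pos: "\<rho> > 0"
    and rho: "\<And>y z v. y \<in> C \<Longrightarrow> z \<in> C \<Longrightarrow> v \<in> clarke_subdiff r z \<Longrightarrow>
                r y - r z - v \<bullet> (y - z) \<le> \<rho> / 2 * (norm (y - z))\<^sup>2"
    \<comment> \<open>feasible set\<close>
    and C: "C \<noteq> {}" "convex C" "compact C"
    \<comment> \<open>algorithm\<close>
    and eta: "\<eta> > 1"
    and x0: "x0 \<in> C"
    and alpha_0: "\<alpha> 0 \<in> {\<rho>..\<eta> * \<rho>}"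
    and alpha_Suc: "\<And>k. \<alpha> (Suc k) \<in> {\<alpha> k..\<eta> * \<rho>}"
    and N_pos: "\<And>k. N k > 0"
    and S_indep: "\<And>k. prob_space.indep_vars P (\<lambda>_. borel) (S k) {..<N k}"
    and S_distr: "\<And>k i. i < N k \<Longrightarrow> distr P borel (S k i) = distr P borel \<xi>"
    and g_meas: "\<And>k. g k \<in> borel_measurable P"
    and g_subdiff: "\<And>k \<omega>. \<omega> \<in> space P \<Longrightarrow> g k \<omega> \<in> clarke_subdiff r (x k \<omega>)"
    and gbar_meas: "\<And>k. gbar k \<in> borel_measurable (past_samples P N S (Suc k))"
    and x_0: "\<And>\<omega>. \<omega> \<in> space P \<Longrightarrow> x 0 \<omega> = x0"
    and dbar: "\<And>k \<omega>. \<omega> \<in> space P \<Longrightarrow>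
                 is_arg_min (\<lambda>d. gbar k \<omega> \<bullet> d + 1 / 2 * \<alpha> k * (norm d)\<^sup>2)
                   (\<lambda>d. x k \<omega> + d \<in> C) (dbar k \<omega>)"
    and x_Suc: "\<And>k \<omega>. \<omega> \<in> space P \<Longrightarrow> x (Suc k) \<omega> = x k \<omega> + dbar k \<omega>"
    \<comment> \<open>noise\<close>
    and gbar_int: "\<And>k. integrable P (gbar k)"
    and gbar_unbiased: "\<And>k b. b \<in> Basis \<Longrightarrow>
                 AE \<omega> in P. real_cond_exp P (past_samples P N S k) (\<lambda>\<omega>. gbar k \<omega> \<bullet> b) \<omega> = g k \<omega> \<bullet> b"
    and M_pos: "\<And>k. M k > 0"
    and gbar_variance: "\<And>k. AE \<omega> in P.
                 nn_cond_exp P (past_samples P N S k)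
                   (\<lambda>\<omega>. ennreal ((norm (gbar k \<omega> - g k \<omega>))\<^sup>2)) \<omega> \<le> ennreal (M k)"
    and M_summable: "summable M"
  shows "AE \<omega> in P. \<forall>xbar. accumulation_point (\<lambda>k. x k \<omega>) xbar \<longrightarrow> kkt_point r C xbar"
proof -

  \<comment> \<open>Feasibility and adaptedness of the iterates\<close>
  interpret prob_space P by (rule P)
  define F where "F = past_samples P N S"
  have closed: "closed C" and bdd: "bounded C"
    using C by (auto dest: compact_imp_closed compact_imp_bounded)
  obtain L where L: "L-lipschitz_on UNIV r" using r_lipschitz by blast
  have \<alpha>: "\<rho> \<le> \<alpha> k \<and> \<alpha> k \<le> \<eta> * \<rho>" for k
    using alpha_0 alpha_Suc by (induction k) (auto intro: order_trans)
  have \<alpha>_pos: "0 < \<alpha> k" for k using \<alpha>[of k] rho_pos by linarith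
  have S_meas: "S j i \<in> borel_measurable P" if "i < N j" for j i
    using S_indep[of j] that by (auto simp: indep_vars_def)
  have subalg: "subalgebra P (F k)" for k
    unfolding F_def by (intro subalgebra_past_samples S_meas)
  have subalg_Suc: "subalgebra (F (Suc k)) (F k)" for k
    unfolding F_def by (rule subalgebra_past_samples_Suc)
  have spF: "space (F k) = space P" for k using subalg[of k] by (simp add: subalgebra_def)
  have sub: "sigma_finite_subalgebra P (F k)" for k
    by (intro finite_measure_subalgebra_is_sigma_finite)
      (unfold_locales, rule subalg)
  have step: "x (Suc k) \<omega> = closest_point C (x k \<omega> - gbar k \<omega> /\<^sub>R \<alpha> k)" if "\<omega> \<in> space P" for k \<omega>
    unfolding x_Suc[OF that] by (rule is_arg_min_prox_step[OF C(2) closed \<alpha>_pos dbar[OF that]])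
  have xC: "x k \<omega> \<in> C" if "\<omega> \<in> space P" for k \<omega>
    using x0 x_0[OF that] step[OF that] closest_point_in_set[OF closed C(1)] by (cases k) auto
  have cp_meas [measurable]: "closest_point C \<in> borel_measurable borel"
    by (intro borel_measurable_continuous_onI continuous_on_closest_point C closed)
  \<comment> \<open>The indices are shifted by one: \<open>gbar k\<close> is known only at
    \<open>F (Suc k)\<close>, which is where \<open>x (Suc k)\<close> has to be measurable.\<close>
  have xF: "x k \<in> borel_measurable (F k)" for k
  proof (induction k)
    case 0
    have "x 0 \<in> borel_measurable (F 0) \<longleftrightarrow> (\<lambda>_. x0) \<in> borel_measurable (F 0)"
      by (intro measurable_cong) (simp add: spF x_0)
    then show ?case by simp
  next
    case (Suc k)
    have [measurable]: "x k \<in> borel_measurable (F (Suc k))"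
      using Suc subalg_Suc by (rule measurable_from_subalg[rotated])
    have [measurable]: "gbar k \<in> borel_measurable (F (Suc k))"
      using gbar_meas by (simp add: F_def)
    have "x (Suc k) \<in> borel_measurable (F (Suc k)) \<longleftrightarrow>
        (\<lambda>\<omega>. closest_point C (x k \<omega> - gbar k \<omega> /\<^sub>R \<alpha> k)) \<in> borel_measurable (F (Suc k))"
      by (intro measurable_cong) (simp add: spF step)
    then show ?case by simp
  qed
  have xP [measurable]: "x k \<in> borel_measurable P" for k
    by (rule measurable_from_subalg[OF subalg xF])
  have gbarP [measurable]: "gbar k \<in> borel_measurable P" for k
    using gbar_meas[folded F_def] by (rule measurable_from_subalg[OF subalg])
  note [measurable] = g_meas

  \<comment> \<open>Second moments of the noise\<close>
  define e where "e k \<omega> = (norm (gbar k \<omega> - g k \<omega>))\<^sup>2" for k \<omega>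
  have e_meas [measurable]: "e k \<in> borel_measurable P" for k unfolding e_def by measurable
  have e_nn: "(\<integral>\<^sup>+ \<omega>. ennreal (e k \<omega>) \<partial>P) \<le> ennreal (M k)" for k
  proof -
    interpret sigma_finite_subalgebra P "F k" by (rule sub)
    \<comment> \<open>Tower property, obtained by integrating the conditional expectation against
      the constant 1.\<close>
    have "(\<integral>\<^sup>+ \<omega>. ennreal (e k \<omega>) \<partial>P)
        = (\<integral>\<^sup>+ \<omega>. nn_cond_exp P (F k) (\<lambda>\<omega>. ennreal (e k \<omega>)) \<omega> \<partial>P)"
      using nn_cond_exp_intg[of "\<lambda>_. 1" "\<lambda>\<omega>. ennreal (e k \<omega>)"] by simp
    also have "\<dots> \<le> (\<integral>\<^sup>+ \<omega>. ennreal (M k) \<partial>P)"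
      using gbar_variance[of k] by (intro nn_integral_mono_AE) (simp add: F_def e_def)
    finally show ?thesis by (simp add: emeasure_space_1)
  qed
  have e_int: "integrable P (e k)" for k
    using e_nn[of k] by (intro integrableI_bounded) (auto simp: e_def top_unique less_top[symmetric])
  have e_le: "expectation (e k) \<le> M k" for k
    using e_nn[of k] M_pos[of k] nn_integral_eq_integral[OF e_int[of k]]
    by (simp add: e_def ennreal_le_iff less_imp_le)

  \<comment> \<open>\<open>g k\<close> is assumed measurable only with respect to \<open>P\<close>.
    Its version \<open>h k\<close>, assembled from the conditional expectations of the coordinates
    of \<open>gbar k\<close>, is measurable with respect to the past.\<close>
  define h where
    "h k \<omega> = (\<Sum>b\<in>Basis. real_cond_exp P (F k) (\<lambda>\<omega>. gbar k \<omega> \<bullet> b) \<omega> *\<^sub>R b)" for k \<omega>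
  have hF [measurable]: "h k \<in> borel_measurable (F k)" for k
    unfolding h_def by measurable
  have h_g: "AE \<omega> in P. h k \<omega> = g k \<omega>" for k
  proof -
    have "AE \<omega> in P. \<forall>b\<in>Basis. real_cond_exp P (F k) (\<lambda>\<omega>. gbar k \<omega> \<bullet> b) \<omega> = g k \<omega> \<bullet> b"
      using gbar_unbiased[of _ k] unfolding F_def by (intro AE_finite_allI) auto
    then show ?thesis
      by eventually_elim (simp add: h_def euclidean_representation)
  qed

  \<comment> \<open>The noise is uncorrelated with the exact-subgradient step\<close>
  define d where "d k \<omega> = closest_point C (x k \<omega> - h k \<omega> /\<^sub>R \<alpha> k) - x k \<omega>" for k \<omega>
  have dF: "d k \<in> borel_measurable (F k)" for k
    using xF[of k] unfolding d_def by measurable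
  obtain B where B: "\<And>y. y \<in> C \<Longrightarrow> norm y \<le> B" using bdd by (auto simp: bounded_iff)
  have B0: "0 \<le> B" using B[OF x0] norm_ge_zero by (rule order_trans[rotated])
  \<comment> \<open>Boundedness of \<open>C\<close> makes \<open>d k\<close> bounded, so its
    products with the merely integrable \<open>gbar k\<close> are integrable.\<close>
  have d_le: "norm (d k \<omega>) \<le> 2 * B" if "\<omega> \<in> space P" for k \<omega>
    unfolding d_def using B[OF closest_point_in_set[OF closed C(1)]] B[OF xC[OF that]]
    by (metis (no_types, opaque_lifting) add_mono mult_2 norm_triangle_ineq4 order_trans)
  have corr: "integrable P (\<lambda>\<omega>. (gbar k \<omega> - h k \<omega>) \<bullet> d k \<omega>) \<and>
      expectation (\<lambda>\<omega>. (gbar k \<omega> - h k \<omega>) \<bullet> d k \<omega>) = 0" for k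
  proof -
    interpret sigma_finite_subalgebra P "F k" by (rule sub)
    let ?c = "\<lambda>b. real_cond_exp P (F k) (\<lambda>\<omega>. gbar k \<omega> \<bullet> b)"
    note [measurable] = dF[THEN measurable_from_subalg[OF subalg]]
    have db: "(\<lambda>\<omega>. d k \<omega> \<bullet> b) \<in> borel_measurable (F k)" for b
      using dF by measurable
    have int: "integrable P (\<lambda>\<omega>. (d k \<omega> \<bullet> b) * (gbar k \<omega> \<bullet> b))" if "b \<in> Basis" for b
    proof (rule Bochner_Integration.integrable_bound)
      show "integrable P (\<lambda>\<omega>. 2 * B * norm (gbar k \<omega>))" using gbar_int by auto
      show "AE \<omega> in P. norm ((d k \<omega> \<bullet> b) * (gbar k \<omega> \<bullet> b)) \<le> norm (2 * B * norm (gbar k \<omega>))"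
      proof (rule AE_I2)
        fix \<omega> assume w: "\<omega> \<in> space P"
        have "\<bar>d k \<omega> \<bullet> b\<bar> \<le> 2 * B"
          using Basis_le_norm[OF that, of "d k \<omega>"] d_le[OF w, of k] by linarith
        moreover have "\<bar>gbar k \<omega> \<bullet> b\<bar> \<le> norm (gbar k \<omega>)" by (rule Basis_le_norm[OF that])
        ultimately have "\<bar>d k \<omega> \<bullet> b\<bar> * \<bar>gbar k \<omega> \<bullet> b\<bar> \<le> (2 * B) * norm (gbar k \<omega>)"
          by (intro mult_mono) auto
        then show "norm ((d k \<omega> \<bullet> b) * (gbar k \<omega> \<bullet> b)) \<le> norm (2 * B * norm (gbar k \<omega>))"
          using B0 by (simp add: abs_mult)
      qed
    qed measurable
    \<comment> \<open>The factor \<open>d k \<omega> \<bullet> b\<close> is known from the past, so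
      under the expectation \<open>gbar k\<close> may be replaced by its conditional
      expectation.\<close>
    have ce: "integrable P (\<lambda>\<omega>. (d k \<omega> \<bullet> b) * ?c b \<omega>)"
      "expectation (\<lambda>\<omega>. (d k \<omega> \<bullet> b) * ?c b \<omega>) = expectation (\<lambda>\<omega>. (d k \<omega> \<bullet> b) * (gbar k \<omega> \<bullet> b))"
      if "b \<in> Basis" for b
      using real_cond_exp_intg[OF int[OF that] db] by auto
    have eq: "(gbar k \<omega> - h k \<omega>) \<bullet> d k \<omega>
        = (\<Sum>b\<in>Basis. (d k \<omega> \<bullet> b) * (gbar k \<omega> \<bullet> b) - (d k \<omega> \<bullet> b) * ?c b \<omega>)" for \<omega>
    proof -
      have "h k \<omega> \<bullet> b = ?c b \<omega>" if "b \<in> Basis" for b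
        unfolding h_def using that by (simp add: inner_sum_left_Basis)
      then show ?thesis
        by (subst euclidean_inner) (intro sum.cong refl, simp add: inner_diff_left algebra_simps)
    qed
    show ?thesis
      unfolding eq using int ce by (auto intro!: sum.neutral)
  qed

  \<comment> \<open>Expected descent and summability of the squared steps\<close>
  have r_cont: "continuous_on UNIV r" using L by (rule lipschitz_on_continuous_on)
  then have [measurable]: "r \<in> borel_measurable borel" by (rule borel_measurable_continuous_onI)
  have "bounded (r ` C)"
    using C(3) r_cont
    by (meson compact_continuous_image compact_imp_bounded continuous_on_subset subset_UNIV)
  then obtain K where K: "\<And>y. y \<in> C \<Longrightarrow> \<bar>r y\<bar> \<le> K" by (auto simp: bounded_iff)
  have r_int: "integrable P (\<lambda>\<omega>. r (x k \<omega>))" for k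
    by (rule integrable_const_bound[where B = K]) (auto intro!: K xC)
  define D where "D k \<omega> = (norm (x (Suc k) \<omega> - x k \<omega>))\<^sup>2" for k \<omega>
  have D_meas [measurable]: "D k \<in> borel_measurable P" for k unfolding D_def by measurable
  have D_int: "integrable P (D k)" for k
  proof (rule integrable_const_bound[where B = "(2 * B)\<^sup>2"])
    show "AE \<omega> in P. norm (D k \<omega>) \<le> (2 * B)\<^sup>2"
    proof (rule AE_I2)
      fix \<omega> assume w: "\<omega> \<in> space P"
      have "norm (x (Suc k) \<omega> - x k \<omega>) \<le> 2 * B"
        using norm_triangle_ineq4[of "x (Suc k) \<omega>" "x k \<omega>"]
          B[OF xC[OF w, of k]] B[OF xC[OF w, of "Suc k"]]
        by linarith
      then show "norm (D k \<omega>) \<le> (2 * B)\<^sup>2"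
        unfolding D_def real_norm_def abs_power2 by (intro power_mono) auto
    qed
  qed measurable
  have descent: "expectation (\<lambda>\<omega>. r (x (Suc k) \<omega>)) + \<rho> / 2 * expectation (D k)
      \<le> expectation (\<lambda>\<omega>. r (x k \<omega>)) + M k / \<rho>" for k
  proof -
    have "expectation (\<lambda>\<omega>. r (x (Suc k) \<omega>) + \<rho> / 2 * D k \<omega>)
        \<le> expectation (\<lambda>\<omega>. r (x k \<omega>) - (gbar k \<omega> - h k \<omega>) \<bullet> d k \<omega> + e k \<omega> / \<rho>)"
    proof (rule integral_mono_AE)
      show "AE \<omega> in P. r (x (Suc k) \<omega>) + \<rho> / 2 * D k \<omega>
          \<le> r (x k \<omega>) - (gbar k \<omega> - h k \<omega>) \<bullet> d k \<omega> + e k \<omega> / \<rho>"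
        using h_g[of k] AE_space
      proof eventually_elim
        case (elim \<omega>)
        let ?s = "x (Suc k) \<omega> - x k \<omega>"
        have "r (x k \<omega> + ?s) - r (x k \<omega>) - g k \<omega> \<bullet> ?s \<le> \<rho> / 2 * (norm ?s)\<^sup>2"
          using rho[OF xC[OF elim(2), of "Suc k"] xC[OF elim(2), of k] g_subdiff[OF elim(2)]] by simp
        then show ?case
          using prox_step_descent[OF C(2) closed xC[OF elim(2), of k] rho_pos,
              of "\<alpha> k" ?s "gbar k \<omega>" r "g k \<omega>"]
            \<alpha>[of k] step[OF elim(2), of k]
          by (simp add: D_def e_def d_def elim(1))
      qed
    qed (use r_int D_int e_int corr in auto)
    \<comment> \<open>The inner product has mean zero by \<open>corr\<close>; only the variance term
      survives.\<close>
    also have "\<dots> = expectation (\<lambda>\<omega>. r (x k \<omega>)) + expectation (e k) / \<rho>"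
      using r_int e_int[of k] corr[of k] by simp
    also have "\<dots> \<le> expectation (\<lambda>\<omega>. r (x k \<omega>)) + M k / \<rho>"
      using e_le[of k] rho_pos by (simp add: divide_right_mono)
    finally show ?thesis using r_int D_int by simp
  qed
  have D_nonneg: "0 \<le> expectation (D k)" for k by (simp add: D_def)
  \<comment> \<open>Telescoped form of \<open>descent\<close>; with \<open>r\<close> bounded below
    on \<open>C\<close> and \<open>M\<close> summable, it bounds the partial sums uniformly.\<close>
  have sums: "\<rho> / 2 * (\<Sum>k<n. expectation (D k)) + expectation (\<lambda>\<omega>. r (x n \<omega>))
      \<le> expectation (\<lambda>\<omega>. r (x 0 \<omega>)) + (\<Sum>k<n. M k) / \<rho>" for n
  proof (induction n)
    case (Suc n)
    then show ?case using descent[of n] by (simp add: distrib_left add_divide_distrib)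
  qed simp
  have r_low: "- K \<le> expectation (\<lambda>\<omega>. r (x n \<omega>))" for n
  proof -
    have "expectation (\<lambda>\<omega>. - K) \<le> expectation (\<lambda>\<omega>. r (x n \<omega>))"
      using K xC r_int by (intro integral_mono) (auto simp: abs_le_iff minus_le_iff)
    then show ?thesis by (simp add: prob_space)
  qed
  have D_summable: "summable (\<lambda>k. expectation (D k))"
  proof (rule summableI_nonneg_bounded[OF D_nonneg])
    fix n
    have "(\<Sum>k<n. M k) / \<rho> \<le> suminf M / \<rho>"
      using M_summable M_pos rho_pos by (intro divide_right_mono sum_le_suminf) (auto simp: less_imp_le)
    then have "\<rho> / 2 * (\<Sum>k<n. expectation (D k)) \<le> expectation (\<lambda>\<omega>. r (x 0 \<omega>)) + suminf M / \<rho> + K"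
      using sums[of n] r_low[of n] by linarith
    then show "(\<Sum>k<n. expectation (D k)) \<le> 2 / \<rho> * (expectation (\<lambda>\<omega>. r (x 0 \<omega>)) + suminf M / \<rho> + K)"
      using rho_pos by (simp add: field_simps)
  qed
  have D_nn: "(\<integral>\<^sup>+ \<omega>. ennreal (D k \<omega>) \<partial>P) = ennreal (expectation (D k))" for k
    by (rule nn_integral_eq_integral[OF D_int]) (simp add: D_def)

  \<comment> \<open>Almost sure limits and conclusion\<close>
  have D_0: "AE \<omega> in P. (\<lambda>k. D k \<omega>) \<longlonglongrightarrow> 0"
    using D_nonneg D_summable D_nn
    by (intro AE_tendsto_zero_of_summable_nn_integral[where m = "\<lambda>k. expectation (D k)"])
      (simp_all, simp add: D_def)
  have e_0: "AE \<omega> in P. (\<lambda>k. e k \<omega>) \<longlonglongrightarrow> 0"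
    using e_nn M_pos M_summable
    by (intro AE_tendsto_zero_of_summable_nn_integral[where m = M]) (auto simp: e_def less_imp_le)
  have null: "f \<longlonglongrightarrow> 0" if "(\<lambda>k. (norm (f k))\<^sup>2) \<longlonglongrightarrow> 0" for f :: "nat \<Rightarrow> 'a"
    using tendsto_real_sqrt[OF that] by (simp add: tendsto_norm_zero_iff)
  \<comment> \<open>The exceptional null set is fixed before \<open>xbar\<close> is chosen, so one
    event serves all accumulation points.\<close>
  from D_0 e_0 AE_space show ?thesis
  proof eventually_elim
    case (elim \<omega>)
    show ?case
    proof (intro allI impI)
      fix xbar assume "accumulation_point (\<lambda>k. x k \<omega>) xbar"
      moreover have "(\<lambda>k. gbar k \<omega> - g k \<omega>) \<longlonglongrightarrow> 0"
        using elim(2) by (intro null) (simp add: e_def)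
      moreover have "(\<lambda>k. x (Suc k) \<omega> - x k \<omega>) \<longlonglongrightarrow> 0"
        using elim(1) by (intro null) (simp add: D_def)
      moreover have "\<alpha> k \<le> \<eta> * \<rho>" for k using \<alpha> by blast
      ultimately show "kkt_point r C xbar"
        by (intro kkt_point_accumulation[where L = L and x = "\<lambda>k. x k \<omega>" and g = "\<lambda>k. g k \<omega>"
              and g' = "\<lambda>k. gbar k \<omega>" and \<alpha> = \<alpha> and b = "\<eta> * \<rho>"])
          (rule C(2) closed L xC[OF elim(3)] g_subdiff[OF elim(3)] \<alpha>_pos step[OF elim(3)] | assumption)+
    qed
  qed
qed

end
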